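(* There is an absolute constant $C$ such that the following holds. Let $R>0$, let $U(x,y)=(y,0)$, let $u=(u_1,u_2)$ be the solution of the perturbation problem described in the context, and let $p_1(x,y,t)$, $p_2(x,y,t)$, $1$-periodic in $x$, be the solutions of $$\left\{\begin{array}{l}\Delta p_1=-\nabla\cdot((u\cdot\nabla)U)-\nabla\cdot((U\cdot\nabla)u),\\ p_{1y}(x,0,t)=\frac1R u_{2yy}(x,0,t),\\ p_{1y}(x,1,t)=\frac1R u_{2yy}(x,1,t),\end{array}\right.$$ and $$\left\{\begin{array}{l}\Delta p_2=-\nabla\cdot((u\cdot\nabla)u),\\ p_{2y}(x,0,t)=0,\\ p_{2y}(x,1,t)=0.\end{array}\right.$$ Then, for all $t\ge0$, $$\|\nabla p_1(\cdot,\cdot,t)\|^2\le C\left(\|u(\cdot,\cdot,t)\|_{H^1}^2+\frac1{R^2}\|u_{2yy}(\cdot,\cdot,t)\|^2+\frac1{R^2}\|u_{2yyy}(\cdot,\cdot,t)\|^2\right)$$ and $$\|\nabla p_2(\cdot,\cdot,t)\|^2\le\|(u\cdot\nabla)u(\cdot,\cdot,t)\|^2 .$$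
   Context: $\Omega=[0,1]\times[0,1]$; all norms are over $\Omega$ in the space variables $(x,y)$: $\|\cdot\|$ is the $L_2(\Omega)$ norm and $\|u\|_{H^1}^2=\|u\|^2+\|Du\|^2$, with $Du$ the matrix of first-order space derivatives (Frobenius norm). Subscripts $x,y,t$ denote partial derivatives, e.g. $u_{2yy}=\partial_y^2u_2$. "Absolute constant" means independent of $R$, $\epsilon$, $t$ and all functions involved. Perturbation problem: $u:\mathbb R\times[0,1]\times[0,\infty)\to\mathbb R^2$ is the smooth solution of $$\left\{\begin{array}{l}u_t+(u\cdot\nabla)U+(U\cdot\nabla)u+\nabla p_1+\epsilon(u\cdot\nabla)u+\epsilon\nabla p_2=\frac1R\Delta u,\\ \nabla\cdot u=0,\\ u(x,0,t)=(0,0),\quad u(x,1,t)=(0,0),\\ u(x,y,t)=u(x+1,y,t),\\ u(x,y,0)=f(x,y),\end{array}\right.$$ where $\epsilon\in\mathbb R$ and $f$ is a smooth, divergence-free initial datum, $1$-periodic in $x$ and compatible with the boundary conditions, normalized by $\|f\|_{H^6_m}=1$. Here, with $D^ju$ denoting the collection of all $j$-th order space derivatives (Frobenius norm) and $\|u\|_{H^2}^2=\sum_{j=0}^2\|D^ju\|^2$, $$\|u\|_{H^6_m}^2=\|u\|_{H^2}^2+\tfrac1{R^2}\|D^3u\|^2+\tfrac1{R^2}\|D^4u\|^2+\tfrac1{R^4}\|u_{2xxyyy}\|^2+\tfrac1{R^4}\|u_{2yyyyy}\|^2+\tfrac1{R^4}\|u_{2yyyyyy}\|^2 .$$ *)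

theory Defs
  imports "HOL-Analysis.Analysis"
begin

section \<open>Differential calculus on the strip\<close>

text \<open>
  A field on the closed strip \<open>\<real> \<times> [0,1]\<close> is a curried function of \<open>x\<close> and \<open>y\<close>; its values for
  \<open>y\<close> outside \<open>[0,1]\<close> are never used.  A time-dependent field takes \<open>t\<close> as its \<^emph>\<open>first\<close>
  argument, so that \<open>u t\<close> is the field \<open>u(\<cdot>,\<cdot>,t)\<close>.  Derivatives in \<open>y\<close> and \<open>t\<close> are taken
  relative to \<open>[0,1]\<close> and \<open>[0,\<infinity>)\<close>, i.e. they are one-sided at the walls and at \<open>t = 0\<close>.
\<close>

definition ddx :: "(real \<Rightarrow> real \<Rightarrow> 'a::real_normed_vector) \<Rightarrow> real \<Rightarrow> real \<Rightarrow> 'a" where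
  "ddx g x y = vector_derivative (\<lambda>s. g s y) (at x)"

definition ddy :: "(real \<Rightarrow> real \<Rightarrow> 'a::real_normed_vector) \<Rightarrow> real \<Rightarrow> real \<Rightarrow> 'a" where
  "ddy g x y = vector_derivative (\<lambda>s. g x s) (at y within {0..1})"

definition ddt :: "(real \<Rightarrow> real \<Rightarrow> real \<Rightarrow> 'a::real_normed_vector) \<Rightarrow> real \<Rightarrow> real \<Rightarrow> real \<Rightarrow> 'a" where
  "ddt g t x y = vector_derivative (\<lambda>s. g s x y) (at t within {0..})"

text \<open>
  \<open>C\<^sup>k\<close> up to the boundary: all iterated partial derivatives of order at most \<open>k\<close>, in any order
  of differentiation, exist and are (jointly) continuous on the closed domain.
\<close>

primrec Ck_strip :: "nat \<Rightarrow> (real \<Rightarrow> real \<Rightarrow> 'a::real_normed_vector) \<Rightarrow> bool" where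
  "Ck_strip 0 g \<longleftrightarrow> continuous_on (UNIV \<times> {0..1}) (\<lambda>(x, y). g x y)"
| "Ck_strip (Suc k) g \<longleftrightarrow>
     continuous_on (UNIV \<times> {0..1}) (\<lambda>(x, y). g x y) \<and>
     (\<forall>x. \<forall>y\<in>{0..1}. (\<lambda>s. g s y) differentiable (at x) \<and>
                    (\<lambda>s. g x s) differentiable (at y within {0..1})) \<and>
     Ck_strip k (ddx g) \<and> Ck_strip k (ddy g)"

definition smooth_strip :: "(real \<Rightarrow> real \<Rightarrow> 'a::real_normed_vector) \<Rightarrow> bool" where
  "smooth_strip g \<longleftrightarrow> (\<forall>k. Ck_strip k g)"

primrec Ck_spacetime :: "nat \<Rightarrow> (real \<Rightarrow> real \<Rightarrow> real \<Rightarrow> 'a::real_normed_vector) \<Rightarrow> bool" where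
  "Ck_spacetime 0 g \<longleftrightarrow> continuous_on ({0..} \<times> UNIV \<times> {0..1}) (\<lambda>(t, x, y). g t x y)"
| "Ck_spacetime (Suc k) g \<longleftrightarrow>
     continuous_on ({0..} \<times> UNIV \<times> {0..1}) (\<lambda>(t, x, y). g t x y) \<and>
     (\<forall>t\<ge>0. \<forall>x. \<forall>y\<in>{0..1}.
        (\<lambda>s. g s x y) differentiable (at t within {0..}) \<and>
        (\<lambda>s. g t s y) differentiable (at x) \<and>
        (\<lambda>s. g t x s) differentiable (at y within {0..1})) \<and>
     Ck_spacetime k (ddt g) \<and> Ck_spacetime k (\<lambda>t. ddx (g t)) \<and> Ck_spacetime k (\<lambda>t. ddy (g t))"

definition smooth_spacetime :: "(real \<Rightarrow> real \<Rightarrow> real \<Rightarrow> 'a::real_normed_vector) \<Rightarrow> bool" where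
  "smooth_spacetime g \<longleftrightarrow> (\<forall>k. Ck_spacetime k g)"

definition periodic_strip :: "(real \<Rightarrow> real \<Rightarrow> 'a) \<Rightarrow> bool" where
  "periodic_strip g \<longleftrightarrow> (\<forall>x. \<forall>y\<in>{0..1}. g (x + 1) y = g x y)"

definition grad :: "(real \<Rightarrow> real \<Rightarrow> real) \<Rightarrow> real \<Rightarrow> real \<Rightarrow> real ^ 2" where
  "grad p x y = vector [ddx p x y, ddy p x y]"

definition divergence :: "(real \<Rightarrow> real \<Rightarrow> real ^ 2) \<Rightarrow> real \<Rightarrow> real \<Rightarrow> real" where
  "divergence v x y = ddx (\<lambda>x y. v x y $ 1) x y + ddy (\<lambda>x y. v x y $ 2) x y"

definition laplacian :: "(real \<Rightarrow> real \<Rightarrow> 'a::real_normed_vector) \<Rightarrow> real \<Rightarrow> real \<Rightarrow> 'a" where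
  "laplacian g x y = ddx (ddx g) x y + ddy (ddy g) x y"

text \<open>The term \<open>(v \<cdot> \<nabla>) w\<close>.\<close>

definition advect :: "(real \<Rightarrow> real \<Rightarrow> real ^ 2) \<Rightarrow> (real \<Rightarrow> real \<Rightarrow> real ^ 2) \<Rightarrow> real \<Rightarrow> real \<Rightarrow> real ^ 2" where
  "advect v w x y = (v x y $ 1) *\<^sub>R ddx w x y + (v x y $ 2) *\<^sub>R ddy w x y"

section \<open>Norms\<close>

definition L2_norm :: "(real \<Rightarrow> real \<Rightarrow> 'a::real_normed_vector) \<Rightarrow> real" where
  "L2_norm g = sqrt (LINT z:{0..1} \<times> {0..1}|lborel. (norm (g (fst z) (snd z)))\<^sup>2)"

text \<open>
  The squared Frobenius norm of the tensor \<open>D\<^sup>j g(x,y)\<close>: the sum runs over all \<open>2\<^sup>j\<close> words of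
  length \<open>j\<close> in \<open>\<partial>\<^sub>x, \<partial>\<^sub>y\<close>, so a mixed derivative is counted once for each order of differentiation.
\<close>

primrec frobenius_sq :: "nat \<Rightarrow> (real \<Rightarrow> real \<Rightarrow> 'a::real_normed_vector) \<Rightarrow> real \<Rightarrow> real \<Rightarrow> real" where
  "frobenius_sq 0 g x y = (norm (g x y))\<^sup>2"
| "frobenius_sq (Suc j) g x y = frobenius_sq j (ddx g) x y + frobenius_sq j (ddy g) x y"

definition D_norm :: "nat \<Rightarrow> (real \<Rightarrow> real \<Rightarrow> 'a::real_normed_vector) \<Rightarrow> real" where
  "D_norm j g = L2_norm (\<lambda>x y. sqrt (frobenius_sq j g x y))"

definition H_norm :: "nat \<Rightarrow> (real \<Rightarrow> real \<Rightarrow> 'a::real_normed_vector) \<Rightarrow> real" where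
  "H_norm k g = sqrt (\<Sum>j\<le>k. (D_norm j g)\<^sup>2)"

definition H6m_norm :: "real \<Rightarrow> (real \<Rightarrow> real \<Rightarrow> real ^ 2) \<Rightarrow> real" where
  "H6m_norm R v =
     (let v2 = (\<lambda>x y. v x y $ 2) in
      sqrt ((H_norm 2 v)\<^sup>2
        + 1 / R\<^sup>2 * (D_norm 3 v)\<^sup>2
        + 1 / R\<^sup>2 * (D_norm 4 v)\<^sup>2
        + 1 / R ^ 4 * (L2_norm (ddy (ddy (ddy (ddx (ddx v2))))))\<^sup>2
        + 1 / R ^ 4 * (L2_norm (ddy (ddy (ddy (ddy (ddy v2))))))\<^sup>2
        + 1 / R ^ 4 * (L2_norm (ddy (ddy (ddy (ddy (ddy (ddy v2)))))))\<^sup>2))"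

section \<open>The perturbation problem and the two pressure problems\<close>

definition couette :: "real \<Rightarrow> real \<Rightarrow> real ^ 2" where
  "couette x y = vector [y, 0]"

text \<open>
  Compatibility with the boundary conditions is stated as the no-slip condition on \<open>f\<close>; the
  higher-order compatibility conditions at \<open>t = 0\<close> are consequences of the smoothness up to
  \<open>t = 0\<close> demanded of the solution with datum \<open>f\<close>.
\<close>

definition initial_datum :: "real \<Rightarrow> (real \<Rightarrow> real \<Rightarrow> real ^ 2) \<Rightarrow> bool" where
  "initial_datum R f \<longleftrightarrow>
     smooth_strip f \<and> periodic_strip f \<and>
     (\<forall>x. \<forall>y\<in>{0..1}. divergence f x y = 0) \<and>
     (\<forall>x. f x 0 = 0 \<and> f x 1 = 0) \<and>
     H6m_norm R f = 1"

definition perturbation_solution ::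
  "real \<Rightarrow> real \<Rightarrow> (real \<Rightarrow> real \<Rightarrow> real ^ 2) \<Rightarrow> (real \<Rightarrow> real \<Rightarrow> real ^ 2) \<Rightarrow>
   (real \<Rightarrow> real \<Rightarrow> real \<Rightarrow> real ^ 2) \<Rightarrow>
   (real \<Rightarrow> real \<Rightarrow> real \<Rightarrow> real) \<Rightarrow> (real \<Rightarrow> real \<Rightarrow> real \<Rightarrow> real) \<Rightarrow> bool" where
  "perturbation_solution R \<epsilon> U f u p1 p2 \<longleftrightarrow>
     smooth_spacetime u \<and>
     (\<forall>t\<ge>0. \<forall>x. \<forall>y\<in>{0..1}.
        ddt u t x y + advect (u t) U x y + advect U (u t) x y + grad (p1 t) x y
          + \<epsilon> *\<^sub>R advect (u t) (u t) x y + \<epsilon> *\<^sub>R grad (p2 t) x y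
        = (1 / R) *\<^sub>R laplacian (u t) x y) \<and>
     (\<forall>t\<ge>0. \<forall>x. \<forall>y\<in>{0..1}. divergence (u t) x y = 0) \<and>
     (\<forall>t\<ge>0. \<forall>x. u t x 0 = 0 \<and> u t x 1 = 0) \<and>
     (\<forall>t\<ge>0. periodic_strip (u t)) \<and>
     (\<forall>x. \<forall>y\<in>{0..1}. u 0 x y = f x y)"

text \<open>
  Pressures are classical solutions, \<open>C\<^sup>2\<close> up to the walls at each time.  No regularity in \<open>t\<close> is
  asked for, since each pressure is determined only up to an additive function of \<open>t\<close>.
\<close>

definition pressure1_solution ::
  "real \<Rightarrow> (real \<Rightarrow> real \<Rightarrow> real ^ 2) \<Rightarrow> (real \<Rightarrow> real \<Rightarrow> real \<Rightarrow> real ^ 2) \<Rightarrow>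
   (real \<Rightarrow> real \<Rightarrow> real \<Rightarrow> real) \<Rightarrow> bool" where
  "pressure1_solution R U u p1 \<longleftrightarrow>
     (\<forall>t\<ge>0. Ck_strip 2 (p1 t) \<and> periodic_strip (p1 t) \<and>
        (\<forall>x. \<forall>y\<in>{0..1}. laplacian (p1 t) x y
            = - divergence (advect (u t) U) x y - divergence (advect U (u t)) x y) \<and>
        (\<forall>x. ddy (p1 t) x 0 = 1 / R * ddy (ddy (\<lambda>x y. u t x y $ 2)) x 0) \<and>
        (\<forall>x. ddy (p1 t) x 1 = 1 / R * ddy (ddy (\<lambda>x y. u t x y $ 2)) x 1))"

definition pressure2_solution ::
  "(real \<Rightarrow> real \<Rightarrow> real \<Rightarrow> real ^ 2) \<Rightarrow> (real \<Rightarrow> real \<Rightarrow> real \<Rightarrow> real) \<Rightarrow> bool" where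
  "pressure2_solution u p2 \<longleftrightarrow>
     (\<forall>t\<ge>0. Ck_strip 2 (p2 t) \<and> periodic_strip (p2 t) \<and>
        (\<forall>x. \<forall>y\<in>{0..1}. laplacian (p2 t) x y = - divergence (advect (u t) (u t)) x y) \<and>
        (\<forall>x. ddy (p2 t) x 0 = 0) \<and>
        (\<forall>x. ddy (p2 t) x 1 = 0))"

end

theory Submission
  imports Defs
begin

text \<open>
  Both pressures solve a Neumann problem \<open>\<Delta>p = - \<nabla> \<cdot> F\<close> on the periodic strip, where the vertical component
  of \<open>F\<close> vanishes on the walls: \<open>F = (u \<cdot> \<nabla>)u\<close> for \<open>p\<^sub>2\<close> and \<open>F = (u \<cdot> \<nabla>)U + (U \<cdot> \<nabla>)u\<close> for \<open>p\<^sub>1\<close>.  Multiplying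
  the equation by \<open>p\<close> and integrating by parts on both sides moves all derivatives from \<open>F\<close> to \<open>p\<close>.  With \<open>h\<close>
  an extension to the strip of the wall values of \<open>p\<^sub>y\<close>, the result is the identity
  \<open>\<parallel>\<nabla>p\<parallel>\<^sup>2 = - \<integral> \<nabla>p \<cdot> F + \<integral> p h\<^sub>y + \<integral> p\<^sub>y h\<close> (\<open>neumann_energy_identity\<close>): the wall integral of \<open>p h\<close> is
  the integral of \<open>\<partial>\<^sub>y(p h)\<close> over the square.

  For \<open>p\<^sub>2\<close> one takes \<open>h = 0\<close>, and Young's inequality for the remaining term gives the bound with constant \<open>1\<close>.

  For \<open>p\<^sub>1\<close> the natural extension is \<open>h = u\<^sub>2\<^sub>y\<^sub>y / R\<close>.  The term \<open>\<integral> p h\<^sub>y\<close> contains the pressure without a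
  derivative, and the pressure is determined only up to a constant.  But \<open>u\<close> is divergence-free and periodic,
  so \<open>u\<^sub>2\<^sub>y = - u\<^sub>1\<^sub>x\<close> has mean zero on each horizontal line, and therefore so have \<open>u\<^sub>2\<^sub>y\<^sub>y\<close>,
  \<open>u\<^sub>2\<^sub>y\<^sub>y\<^sub>y\<close> and \<open>h\<^sub>y\<close>.  Hence \<open>p(0,y)\<close> can be subtracted from \<open>p(x,y)\<close> on each line, and the one-dimensional
  Poincare inequality bounds the difference by \<open>p\<^sub>x\<close> (\<open>square_integral_mult_mean_zero_le\<close>).  Young's inequality
  with suitable weights then absorbs half of \<open>\<parallel>\<nabla>p\<parallel>\<^sup>2\<close> (\<open>neumann_energy_estimate\<close>).  Finally
  \<open>F = (u\<^sub>2, 0) + y u\<^sub>x\<close> satisfies \<open>\<parallel>F\<parallel>\<^sup>2 \<le> 2 \<parallel>u\<parallel>\<^sup>2\<close> in the norm of \<open>H\<^sup>1\<close>, so that \<open>C = 4\<close> suffices.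
\<close>

section \<open>Fields of class \<open>C\<^sup>k\<close> on the strip\<close>

lemma ddx_eqI:
  assumes "((\<lambda>s. g s y) has_vector_derivative D) (at x)"
  shows "ddx g x y = D"
  unfolding ddx_def using assms by (rule vector_derivative_at)

lemma ddy_eqI:
  assumes "((\<lambda>s. g x s) has_vector_derivative D) (at y within {0..1})" "y \<in> {0..1}"
  shows "ddy g x y = D"
proof -
  have "at y within {0..1::real} \<noteq> bot"
    using assms(2) islimpt_Icc[of 0 1 y] by (simp add: trivial_limit_within)
  then show ?thesis
    unfolding ddy_def using assms(1) by (rule vector_derivative_within)
qed

text \<open>
  Two fields that agree on the strip may differ elsewhere, so their partial derivatives can only be
  compared on the strip.  This lemma, \<open>ddy_cong\<close> and \<open>Ck_strip_cong\<close> justify replacing a field by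
  another formula for it that is valid on the strip only, such as a formula for one of its derivatives.
\<close>

lemma ddx_cong:
  assumes "\<And>x y. y \<in> {0..1} \<Longrightarrow> f x y = g x y" "y \<in> {0..1}"
  shows "ddx f x y = ddx g x y"
  using assms by (simp add: ddx_def)

lemma ddy_cong:
  assumes "\<And>x y. y \<in> {0..1} \<Longrightarrow> f x y = g x y" "y \<in> {0..1}"
  shows "ddy f x y = ddy g x y"
  unfolding ddy_def using assms by (intro vector_derivative_cong_eq always_eventually) auto

lemma Ck_strip_has_ddx:
  assumes "Ck_strip (Suc k) g" "y \<in> {0..1}"
  shows "((\<lambda>s. g s y) has_vector_derivative ddx g x y) (at x)"
  using assms by (simp add: ddx_def vector_derivative_works)

lemma Ck_strip_has_ddy:
  assumes "Ck_strip (Suc k) g" "y \<in> {0..1}"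
  shows "((\<lambda>s. g x s) has_vector_derivative ddy g x y) (at y within {0..1})"
  using assms by (simp add: ddy_def vector_derivative_works)

lemma Ck_strip_cong:
  assumes "Ck_strip k f" "\<And>x y. y \<in> {0..1} \<Longrightarrow> f x y = g x y"
  shows "Ck_strip k g"
  using assms
proof (induction k arbitrary: f g)
  case 0
  have "continuous_on (UNIV \<times> {0..1}) (\<lambda>(x, y). g x y) = continuous_on (UNIV \<times> {0..1}) (\<lambda>(x, y). f x y)"
    by (rule continuous_on_cong) (use 0 in auto)
  then show ?case using 0 by simp
next
  case (Suc k)
  have "continuous_on (UNIV \<times> {0..1}) (\<lambda>(x, y). g x y) = continuous_on (UNIV \<times> {0..1}) (\<lambda>(x, y). f x y)"
    by (rule continuous_on_cong) (use Suc in auto)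
  then have "continuous_on (UNIV \<times> {0..1}) (\<lambda>(x, y). g x y)" using Suc by simp
  moreover have "(\<lambda>s. g s y) differentiable (at x)" if "y \<in> {0..1}" for x y
    using Suc.prems that by simp
  moreover have "(\<lambda>s. g x s) differentiable (at y within {0..1})" if "y \<in> {0..1}" for x y
    by (rule differentiable_transform_within[of "f x" _ _ 1]) (use Suc.prems that in auto)
  moreover have "Ck_strip k (ddx g)"
    by (rule Suc.IH[of "ddx f"]) (use Suc.prems in \<open>auto intro: ddx_cong\<close>)
  moreover have "Ck_strip k (ddy g)"
    by (rule Suc.IH[of "ddy f"]) (use Suc.prems in \<open>auto intro: ddy_cong\<close>)
  ultimately show ?case by simp
qed

text \<open>
  Closure of the classes \<open>C\<^sup>k\<close> under algebraic operations is proved by induction on \<open>k\<close>: the familiar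
  differentiation rules provide \<open>gx\<close> and \<open>gy\<close>, which are \<open>C\<^sup>k\<close> by induction, and by the congruence lemmas
  it does not matter that they equal \<open>ddx g\<close> and \<open>ddy g\<close> only on the strip.
\<close>

lemma Ck_strip_SucI:
  assumes "Ck_strip 0 g" "Ck_strip k gx" "Ck_strip k gy"
    and x: "\<And>x y. y \<in> {0..1} \<Longrightarrow> ((\<lambda>s. g s y) has_vector_derivative gx x y) (at x)"
    and y: "\<And>x y. y \<in> {0..1} \<Longrightarrow> ((\<lambda>s. g x s) has_vector_derivative gy x y) (at y within {0..1})"
  shows "Ck_strip (Suc k) g"
proof -
  have "Ck_strip k (ddx g)"
    by (rule Ck_strip_cong[OF assms(2)]) (simp add: ddx_eqI[OF x])
  moreover have "Ck_strip k (ddy g)"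
    by (rule Ck_strip_cong[OF assms(3)]) (simp add: ddy_eqI[OF y])
  ultimately show ?thesis
    using assms(1) differentiableI_vector[OF x] differentiableI_vector[OF y] by simp
qed

lemma Ck_strip_imp_C0: "Ck_strip k g \<Longrightarrow> Ck_strip 0 g"
  by (cases k) auto

lemma Ck_strip_SucD: "Ck_strip (Suc k) g \<Longrightarrow> Ck_strip k g"
proof (induction k arbitrary: g)
  case 0
  then show ?case by simp
next
  case (Suc k)
  have "Ck_strip k (ddx g)" "Ck_strip k (ddy g)"
    using Suc.prems by (auto intro!: Suc.IH simp del: Ck_strip.simps(1))
  then show ?case using Suc.prems by auto
qed

lemma Ck_strip_bounded_linear:
  assumes "bounded_linear h" "Ck_strip k g"
  shows "Ck_strip k (\<lambda>x y. h (g x y))"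
  using assms(2)
proof (induction k arbitrary: g)
  case 0
  then show ?case
    by (auto simp: case_prod_beta intro: bounded_linear.continuous_on[OF assms(1)])
next
  case (Suc k)
  have "Ck_strip 0 (\<lambda>x y. h (g x y))"
    using Suc.prems by (auto simp: case_prod_beta intro: bounded_linear.continuous_on[OF assms(1)])
  then show ?case
    by (rule Ck_strip_SucI[where gx = "\<lambda>x y. h (ddx g x y)" and gy = "\<lambda>x y. h (ddy g x y)"])
      (use Suc Ck_strip_has_ddx[OF Suc.prems] Ck_strip_has_ddy[OF Suc.prems] in
        \<open>auto intro: bounded_linear.has_vector_derivative[OF assms(1)]\<close>)
qed

lemma Ck_strip_add:
  assumes "Ck_strip k f" "Ck_strip k g"
  shows "Ck_strip k (\<lambda>x y. f x y + g x y)"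
  using assms
proof (induction k arbitrary: f g)
  case 0
  then show ?case by (auto simp: case_prod_beta intro: continuous_intros)
next
  case (Suc k)
  have "Ck_strip 0 (\<lambda>x y. f x y + g x y)"
    using Suc.prems by (auto simp: case_prod_beta intro: continuous_intros)
  then show ?case
    by (rule Ck_strip_SucI[where gx = "\<lambda>x y. ddx f x y + ddx g x y" and gy = "\<lambda>x y. ddy f x y + ddy g x y"])
      (use Suc Ck_strip_has_ddx[OF Suc.prems(1)] Ck_strip_has_ddy[OF Suc.prems(1)]
         Ck_strip_has_ddx[OF Suc.prems(2)] Ck_strip_has_ddy[OF Suc.prems(2)] in
        \<open>auto intro: has_vector_derivative_add\<close>)
qed

lemma Ck_strip_scaleR:
  fixes f :: "real \<Rightarrow> real \<Rightarrow> real" and g :: "real \<Rightarrow> real \<Rightarrow> 'a::real_normed_vector"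
  assumes "Ck_strip k f" "Ck_strip k g"
  shows "Ck_strip k (\<lambda>x y. f x y *\<^sub>R g x y)"
  using assms
proof (induction k arbitrary: f g)
  case 0
  then show ?case by (auto simp: case_prod_beta intro: continuous_intros)
next
  case (Suc k)
  note S = Ck_strip_SucD[OF Suc.prems(1)] Ck_strip_SucD[OF Suc.prems(2)]
  have D: "Ck_strip k (ddx f)" "Ck_strip k (ddy f)" "Ck_strip k (ddx g)" "Ck_strip k (ddy g)"
    using Suc.prems by auto
  have "Ck_strip 0 (\<lambda>x y. f x y *\<^sub>R g x y)"
    using Suc.prems by (auto simp: case_prod_beta intro: continuous_intros)
  then show ?case
  proof (rule Ck_strip_SucI)
    show "Ck_strip k (\<lambda>x y. f x y *\<^sub>R ddx g x y + ddx f x y *\<^sub>R g x y)"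
      "Ck_strip k (\<lambda>x y. f x y *\<^sub>R ddy g x y + ddy f x y *\<^sub>R g x y)"
      by (intro Ck_strip_add Suc.IH S D)+
  next
    fix x y :: real assume y: "y \<in> {0..1}"
    show "((\<lambda>s. f s y *\<^sub>R g s y) has_vector_derivative f x y *\<^sub>R ddx g x y + ddx f x y *\<^sub>R g x y) (at x)"
      by (rule has_vector_derivative_scaleR)
        (simp_all add: has_real_derivative_iff_has_vector_derivative Ck_strip_has_ddx[OF Suc.prems(1) y] Ck_strip_has_ddx[OF Suc.prems(2) y])
    show "((\<lambda>s. f x s *\<^sub>R g x s) has_vector_derivative f x y *\<^sub>R ddy g x y + ddy f x y *\<^sub>R g x y) (at y within {0..1})"
      by (rule has_vector_derivative_scaleR)
        (simp_all add: has_real_derivative_iff_has_vector_derivative Ck_strip_has_ddy[OF Suc.prems(1) y] Ck_strip_has_ddy[OF Suc.prems(2) y])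
  qed
qed

lemma Ck_strip_const: "Ck_strip k (\<lambda>x y. c)"
proof (induction k arbitrary: c)
  case (Suc k)
  show ?case
    by (rule Ck_strip_SucI[where gx = "\<lambda>x y. 0" and gy = "\<lambda>x y. 0"]) (use Suc in auto)
qed simp

lemma Ck_strip_height: "Ck_strip k (\<lambda>x y. y)"
proof (cases k)
  case (Suc m)
  have "Ck_strip 0 (\<lambda>x y::real. y)"
    by (auto simp: case_prod_beta intro: continuous_intros)
  then show ?thesis
    unfolding Suc by (rule Ck_strip_SucI[where gx = "\<lambda>x y. 0" and gy = "\<lambda>x y. 1"]) (auto intro: Ck_strip_const)
qed (auto simp: case_prod_beta intro: continuous_intros)

lemma Ck_spacetime_imp_Ck_strip:
  assumes "Ck_spacetime k u" "t \<ge> 0"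
  shows "Ck_strip k (u t)"
  using assms(1)
proof (induction k arbitrary: u)
  case 0
  have "continuous_on (UNIV \<times> {0..1}) ((\<lambda>(t, x, y). u t x y) \<circ> (\<lambda>z. (t, z)))"
    by (rule continuous_on_compose)
      (use 0 assms(2) in \<open>auto intro!: continuous_intros elim!: continuous_on_subset\<close>)
  then show ?case by (simp add: o_def case_prod_beta)
next
  case (Suc k)
  have "continuous_on (UNIV \<times> {0..1}) ((\<lambda>(t, x, y). u t x y) \<circ> (\<lambda>z. (t, z)))"
    by (rule continuous_on_compose)
      (use Suc assms(2) in \<open>auto intro!: continuous_intros elim!: continuous_on_subset\<close>)
  then have "continuous_on (UNIV \<times> {0..1}) (\<lambda>(x, y). u t x y)" by (simp add: o_def case_prod_beta)
  moreover have "Ck_strip k (ddx (u t))" "Ck_strip k (ddy (u t))"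
    using Suc.IH[of "\<lambda>t. ddx (u t)"] Suc.IH[of "\<lambda>t. ddy (u t)"] Suc.prems by auto
  ultimately show ?case using Suc.prems assms(2) by auto
qed

lemma bounded_linear_vector_first: "bounded_linear (\<lambda>y. vector [y, 0] :: real ^ 2)"
proof -
  have "(\<lambda>y. vector [y, 0] :: real ^ 2) = (\<lambda>y. y *\<^sub>R vector [1, 0])"
    by (auto simp: vec_eq_iff forall_2 vector_2)
  then show ?thesis by (simp add: bounded_linear_scaleR_left)
qed

lemma Ck_strip_couette: "Ck_strip k couette"
  using Ck_strip_bounded_linear[OF bounded_linear_vector_first Ck_strip_height, of k]
  by (rule Ck_strip_cong) (simp add: couette_def)

lemma Ck_strip_component:
  fixes v :: "real \<Rightarrow> real \<Rightarrow> real ^ 'n"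
  assumes "Ck_strip k v" shows "Ck_strip k (\<lambda>x y. v x y $ i)"
  using bounded_linear_vec_nth assms by (rule Ck_strip_bounded_linear)

lemma Ck_strip_advect:
  assumes "Ck_strip (Suc k) v" "Ck_strip (Suc k) w"
  shows "Ck_strip k (advect v w)"
proof -
  have "Ck_strip k (ddx w)" "Ck_strip k (ddy w)" using assms by auto
  then have "Ck_strip k (\<lambda>x y. (v x y $ 1) *\<^sub>R ddx w x y + (v x y $ 2) *\<^sub>R ddy w x y)"
    by (intro Ck_strip_add Ck_strip_scaleR Ck_strip_component Ck_strip_SucD[OF assms(1)])
  then show ?thesis by (rule Ck_strip_cong) (simp add: advect_def)
qed

lemma periodic_strip_ddx:
  assumes "periodic_strip (g :: real \<Rightarrow> real \<Rightarrow> 'a::real_normed_vector)"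
  shows "periodic_strip (ddx g)"
  unfolding periodic_strip_def
proof safe
  fix x y :: real assume y: "y \<in> {0..1}"
  \<comment> \<open>The same translation argument serves for both directions, with \<open>c = 1\<close> and \<open>c = -1\<close>.\<close>
  have shift: "(h has_vector_derivative D) (at z)"
    if "(h has_vector_derivative D) (at (z + c))" "\<And>s. h (s + c) = h s"
    for h :: "real \<Rightarrow> 'a" and D z c
  proof -
    have "((\<lambda>s. s + c) has_vector_derivative 1) (at z)"
      by (auto intro!: derivative_eq_intros)
    from vector_diff_chain_at[OF this that(1)] show ?thesis
      by (simp add: o_def that(2))
  qed
  have per: "g (s + 1) y = g s y" for s
    using assms y by (simp add: periodic_strip_def)
  have "((\<lambda>s. g s y) has_vector_derivative D) (at (x + 1)) \<longleftrightarrow>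
      ((\<lambda>s. g s y) has_vector_derivative D) (at x)" for D
    using shift[of "\<lambda>s. g s y" D x 1] shift[of "\<lambda>s. g s y" D "x + 1" "- 1"] per per[of "_ - 1"]
    by auto
  then show "ddx g (x + 1) y = ddx g x y" by (simp add: ddx_def vector_derivative_def)
qed

lemma periodic_strip_ddy:
  assumes "periodic_strip g" shows "periodic_strip (ddy g)"
  unfolding periodic_strip_def ddy_def
proof safe
  fix x y :: real assume y: "y \<in> {0..1}"
  show "vector_derivative (g (x + 1)) (at y within {0..1}) = vector_derivative (g x) (at y within {0..1})"
    by (rule vector_derivative_cong_eq) (use assms y in \<open>auto simp: periodic_strip_def\<close>)
qed

lemma periodic_strip_advect:
  assumes "periodic_strip v" "periodic_strip w" shows "periodic_strip (advect v w)"
  using assms periodic_strip_ddx[OF assms(2)] periodic_strip_ddy[OF assms(2)]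
  by (simp add: periodic_strip_def advect_def)

section \<open>Integration over the unit square\<close>

text \<open>
  The same notion as \<open>Ck_strip 0\<close>, as a separate constant because the simplifier unfolds the recursive
  predicate into a statement about \<open>case_prod\<close>, to which the continuity rules do not apply directly.
\<close>

definition cont_strip :: "(real \<Rightarrow> real \<Rightarrow> 'a::real_normed_vector) \<Rightarrow> bool" where
  "cont_strip g \<longleftrightarrow> continuous_on (UNIV \<times> {0..1}) (\<lambda>z. g (fst z) (snd z))"

definition square_integral :: "(real \<Rightarrow> real \<Rightarrow> real) \<Rightarrow> real" where
  "square_integral g = integral ({0..1} \<times> {0..1}) (\<lambda>z. g (fst z) (snd z))"

lemma Ck_strip_imp_cont_strip: "Ck_strip k g \<Longrightarrow> cont_strip g"
  using Ck_strip_imp_C0[of k g] by (simp add: cont_strip_def case_prod_beta)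

lemma cont_strip_intros:
  fixes f g :: "real \<Rightarrow> real \<Rightarrow> real" and v :: "real \<Rightarrow> real \<Rightarrow> real ^ 2"
  shows "cont_strip f \<Longrightarrow> cont_strip g \<Longrightarrow> cont_strip (\<lambda>x y. f x y + g x y)"
    "cont_strip f \<Longrightarrow> cont_strip g \<Longrightarrow> cont_strip (\<lambda>x y. f x y * g x y)"
    "cont_strip f \<Longrightarrow> cont_strip (\<lambda>x y. (f x y) ^ n)"
    "cont_strip (\<lambda>x y. c :: real)"
    "cont_strip v \<Longrightarrow> cont_strip (\<lambda>x y. norm (v x y))"
    "cont_strip v \<Longrightarrow> cont_strip (\<lambda>x y. v x y $ i)"
  unfolding cont_strip_def by (intro continuous_intros; assumption)+

lemma unit_square_eq_cbox: "{0..1} \<times> {0..1} = cbox (0::real, 0::real) (1, 1)"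
  by (auto simp: cbox_Pair_eq)

lemma cont_strip_on_square:
  "cont_strip g \<Longrightarrow> continuous_on ({0..1} \<times> {0..1}) (\<lambda>z. g (fst z) (snd z))"
  unfolding cont_strip_def by (erule continuous_on_subset) auto

lemma cont_strip_integrable:
  fixes g :: "real \<Rightarrow> real \<Rightarrow> real"
  shows "cont_strip g \<Longrightarrow> (\<lambda>z. g (fst z) (snd z)) integrable_on {0..1} \<times> {0..1}"
  unfolding unit_square_eq_cbox
  by (rule integrable_continuous, fold unit_square_eq_cbox) (rule cont_strip_on_square)

lemma cont_strip_row: "cont_strip g \<Longrightarrow> y \<in> {0..1} \<Longrightarrow> continuous_on S (\<lambda>x. g x y)"
  unfolding cont_strip_def
  by (rule continuous_on_compose2[where f = "\<lambda>x. (x, y)" and g = "\<lambda>z. g (fst z) (snd z)", simplified])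
    (auto intro: continuous_intros)

text \<open>
  Every integrand below is continuous up to the walls, so the integral over the square is an iterated
  integral in either order: the inner integral is taken in the direction of the derivative that is
  to be integrated by parts.
\<close>

lemma square_integral_xy:
  assumes "cont_strip g"
  shows "square_integral g = integral {0..1} (\<lambda>x. integral {0..1} (\<lambda>y. g x y))"
  using integral_prod_continuous[OF cont_strip_on_square[OF assms, unfolded unit_square_eq_cbox]]
  by (simp add: square_integral_def unit_square_eq_cbox)

lemma square_integral_yx:
  assumes "cont_strip g"
  shows "square_integral g = integral {0..1} (\<lambda>y. integral {0..1} (\<lambda>x. g x y))"
proof -
  have "continuous_on (cbox (0, 0) (1, 1)) (\<lambda>(x, y). g x y)"
    using cont_strip_on_square[OF assms] by (simp add: unit_square_eq_cbox case_prod_beta)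
  from integral_swap_continuous[OF this] show ?thesis
    by (simp add: square_integral_xy[OF assms])
qed

lemma square_integral_add:
  assumes "cont_strip f" "cont_strip g"
  shows "square_integral (\<lambda>x y. f x y + g x y) = square_integral f + square_integral g"
  unfolding square_integral_def by (intro integral_add cont_strip_integrable assms)

lemma square_integral_mult: "square_integral (\<lambda>x y. c * f x y) = c * square_integral f"
  unfolding square_integral_def by (rule integral_mult_right)

lemma square_integral_mono:
  assumes "cont_strip f" "cont_strip g" "\<And>x y. x \<in> {0..1} \<Longrightarrow> y \<in> {0..1} \<Longrightarrow> f x y \<le> g x y"
  shows "square_integral f \<le> square_integral g"
  unfolding square_integral_def
  by (intro integral_le cont_strip_integrable assms(1,2)) (auto intro: assms(3))

lemma square_integral_cong:
  assumes "\<And>x y. y \<in> {0..1} \<Longrightarrow> f x y = g x y"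
  shows "square_integral f = square_integral g"
  unfolding square_integral_def by (rule integral_cong) (auto intro: assms)

lemma square_integral_nonneg:
  assumes "cont_strip f" "\<And>x y. 0 \<le> f x y"
  shows "0 \<le> square_integral f"
  unfolding square_integral_def by (intro integral_nonneg cont_strip_integrable assms)

lemma L2_norm_power2:
  fixes g :: "real \<Rightarrow> real \<Rightarrow> 'a::real_normed_vector"
  assumes "cont_strip (\<lambda>x y. (norm (g x y))\<^sup>2)"
  shows "(L2_norm g)\<^sup>2 = square_integral (\<lambda>x y. (norm (g x y))\<^sup>2)"
proof -
  have "set_integrable lborel ({0..1} \<times> {0..1}) (\<lambda>z. (norm (g (fst z) (snd z)))\<^sup>2)"
    unfolding set_integrable_def
    by (rule borel_integrable_compact) (use cont_strip_on_square[OF assms] in \<open>auto intro: compact_Times\<close>)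
  then have "(LINT z:{0..1} \<times> {0..1}|lborel. (norm (g (fst z) (snd z)))\<^sup>2)
      = square_integral (\<lambda>x y. (norm (g x y))\<^sup>2)"
    unfolding square_integral_def by (rule set_borel_integral_eq_integral)
  moreover have "0 \<le> square_integral (\<lambda>x y. (norm (g x y))\<^sup>2)"
    using assms by (rule square_integral_nonneg) simp
  ultimately show ?thesis by (simp add: L2_norm_def)
qed

text \<open>
  The boundary terms on the vertical sides \<open>x = 0\<close> and \<open>x = 1\<close> cancel by periodicity.
\<close>

lemma square_integral_by_parts_x:
  assumes p: "Ck_strip 1 p" "periodic_strip p" and g: "Ck_strip 1 g" "periodic_strip g"
  shows "square_integral (\<lambda>x y. p x y * ddx g x y) = - square_integral (\<lambda>x y. ddx p x y * g x y)"
proof -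
  have c: "cont_strip p" "cont_strip g" "cont_strip (ddx p)" "cont_strip (ddx g)"
    using p g by (auto intro: Ck_strip_imp_cont_strip[of 1] Ck_strip_imp_cont_strip[of 0])
  have cs: "cont_strip (\<lambda>x y. p x y * ddx g x y)" "cont_strip (\<lambda>x y. ddx p x y * g x y)"
    by (intro cont_strip_intros c)+
  have "integral {0..1} (\<lambda>x. p x y * ddx g x y + ddx p x y * g x y) = 0" if y: "y \<in> {0..1}" for y
  proof -
    have "((\<lambda>x. p x y * ddx g x y + ddx p x y * g x y) has_integral p 1 y * g 1 y - p 0 y * g 0 y) {0..1}"
    proof (rule fundamental_theorem_of_calculus)
      fix x :: real
      have "((\<lambda>s. p s y * g s y) has_vector_derivative p x y * ddx g x y + ddx p x y * g x y) (at x)"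
        by (rule has_vector_derivative_mult) (use p g y in \<open>auto intro!: Ck_strip_has_ddx[of 0] simp del: Ck_strip.simps(1)\<close>)
      then show "((\<lambda>s. p s y * g s y) has_vector_derivative p x y * ddx g x y + ddx p x y * g x y)
          (at x within {0..1})"
        by (rule has_vector_derivative_at_within)
    qed simp
    moreover have "p 1 y = p 0 y" "g 1 y = g 0 y"
      using p(2) g(2) y unfolding periodic_strip_def by (metis add_0)+
    ultimately show ?thesis by (simp add: integral_unique)
  qed
  then have "integral {0..1} (\<lambda>y. integral {0..1} (\<lambda>x. p x y * ddx g x y + ddx p x y * g x y)) = integral {0..1} (\<lambda>y::real. 0::real)"
    by (rule integral_cong)
  then have "square_integral (\<lambda>x y. p x y * ddx g x y + ddx p x y * g x y) = 0"
    by (subst square_integral_yx) (auto intro!: cont_strip_intros cs)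
  then show ?thesis by (simp add: square_integral_add[OF cs])
qed

text \<open>
  The right-hand side depends on \<open>g\<close> only through its values on the walls, so that two functions with
  the same wall values have equal left-hand sides; this is how a wall integral is turned into an area
  integral later.
\<close>

lemma square_integral_by_parts_y:
  assumes p: "Ck_strip 1 p" and g: "Ck_strip 1 g"
  shows "square_integral (\<lambda>x y. p x y * ddy g x y) + square_integral (\<lambda>x y. ddy p x y * g x y)
    = integral {0..1} (\<lambda>x. p x 1 * g x 1 - p x 0 * g x 0)"
proof -
  have c: "cont_strip p" "cont_strip g" "cont_strip (ddy p)" "cont_strip (ddy g)"
    using p g by (auto intro: Ck_strip_imp_cont_strip[of 1] Ck_strip_imp_cont_strip[of 0])
  have cs: "cont_strip (\<lambda>x y. p x y * ddy g x y)" "cont_strip (\<lambda>x y. ddy p x y * g x y)"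
    by (intro cont_strip_intros c)+
  have "integral {0..1} (\<lambda>y. p x y * ddy g x y + ddy p x y * g x y) = p x 1 * g x 1 - p x 0 * g x 0" for x
  proof (rule integral_unique, rule fundamental_theorem_of_calculus)
    fix y :: real assume "y \<in> {0..1}"
    then show "((\<lambda>s. p x s * g x s) has_vector_derivative p x y * ddy g x y + ddy p x y * g x y)
        (at y within {0..1})"
      by (intro has_vector_derivative_mult) (use p g in \<open>auto intro!: Ck_strip_has_ddy[of 0] simp del: Ck_strip.simps(1)\<close>)
  qed simp
  then have "square_integral (\<lambda>x y. p x y * ddy g x y + ddy p x y * g x y)
      = integral {0..1} (\<lambda>x. p x 1 * g x 1 - p x 0 * g x 0)"
    by (subst square_integral_xy) (auto intro!: cont_strip_intros cs integral_cong)
  then show ?thesis by (simp add: square_integral_add[OF cs])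
qed

section \<open>Green's identities for periodic fields\<close>

lemma norm_grad_power2: "(norm (grad p x y))\<^sup>2 = (ddx p x y)\<^sup>2 + (ddy p x y)\<^sup>2"
  by (simp add: grad_def norm_vec_def L2_set_def UNIV_2 vector_2)

lemma inner_grad: "grad p x y \<bullet> w = ddx p x y * w $ 1 + ddy p x y * w $ 2"
  by (simp add: grad_def inner_vec_def UNIV_2 vector_2)

text \<open>
  The condition on \<open>F\<close> is that nothing flows through the walls; then the weak form of the divergence
  has no wall terms.  Since only \<open>F\<close> itself remains on the right, estimates involve no derivative of \<open>F\<close>.
\<close>

lemma square_integral_divergence:
  fixes F :: "real \<Rightarrow> real \<Rightarrow> real ^ 2"
  assumes p: "Ck_strip 1 p" "periodic_strip p"
    and F: "Ck_strip 1 F" "periodic_strip F" "\<And>x. F x 0 $ 2 = 0" "\<And>x. F x 1 $ 2 = 0"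
  shows "square_integral (\<lambda>x y. p x y * divergence F x y) = - square_integral (\<lambda>x y. grad p x y \<bullet> F x y)"
proof -
  have F': "Ck_strip 1 (\<lambda>x y. F x y $ i)" "periodic_strip (\<lambda>x y. F x y $ i)" for i
    using F(1,2) by (auto simp: periodic_strip_def intro: Ck_strip_component simp del: Ck_strip.simps)
  have c: "cont_strip p" "cont_strip (ddx p)" "cont_strip (ddy p)" "cont_strip F"
    "cont_strip (ddx (\<lambda>x y. F x y $ 1))" "cont_strip (ddy (\<lambda>x y. F x y $ 2))"
    using p F(1) F' by (auto intro: Ck_strip_imp_cont_strip[of 1] Ck_strip_imp_cont_strip[of 0])
  have "square_integral (\<lambda>x y. p x y * divergence F x y)
      = square_integral (\<lambda>x y. p x y * ddx (\<lambda>x y. F x y $ 1) x y) + square_integral (\<lambda>x y. p x y * ddy (\<lambda>x y. F x y $ 2) x y)"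
    unfolding divergence_def distrib_left by (intro square_integral_add cont_strip_intros c)
  also have "square_integral (\<lambda>x y. p x y * ddx (\<lambda>x y. F x y $ 1) x y) = - square_integral (\<lambda>x y. ddx p x y * F x y $ 1)"
    by (intro square_integral_by_parts_x p F')
  also have "square_integral (\<lambda>x y. p x y * ddy (\<lambda>x y. F x y $ 2) x y) = - square_integral (\<lambda>x y. ddy p x y * F x y $ 2)"
    using square_integral_by_parts_y[OF p(1) F'(1), of 2] by (simp add: F(3,4))
  also have "- square_integral (\<lambda>x y. ddx p x y * F x y $ 1) + - square_integral (\<lambda>x y. ddy p x y * F x y $ 2)
      = - square_integral (\<lambda>x y. grad p x y \<bullet> F x y)"
    unfolding inner_grad by (subst square_integral_add) (intro cont_strip_intros c | simp)+
  finally show ?thesis .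
qed

text \<open>
  Green's identity produces the wall integral of \<open>p \<cdot> p\<^sub>y\<close>.  As \<open>p\<^sub>y\<close> and \<open>h\<close> agree on the walls, this is
  the wall integral of \<open>p \<cdot> h\<close>, i.e. the area integral of \<open>\<partial>\<^sub>y (p h) = p h\<^sub>y + p\<^sub>y h\<close>.  This
  replaces the wall values of \<open>p\<close> by quantities that the energy controls.
\<close>

lemma dirichlet_energy_identity:
  assumes p: "Ck_strip 2 p" "periodic_strip p" and h: "Ck_strip 1 h"
    and walls: "\<And>x. ddy p x 0 = h x 0" "\<And>x. ddy p x 1 = h x 1"
  shows "square_integral (\<lambda>x y. (norm (grad p x y))\<^sup>2) = - square_integral (\<lambda>x y. p x y * laplacian p x y)
    + square_integral (\<lambda>x y. p x y * ddy h x y) + square_integral (\<lambda>x y. ddy p x y * h x y)"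
proof -
  have p1: "Ck_strip 1 p" "Ck_strip 1 (ddx p)" "Ck_strip 1 (ddy p)"
    using p Ck_strip_SucD[of 1 p] by (auto simp: numeral_2_eq_2)
  have c: "cont_strip p" "cont_strip (ddx p)" "cont_strip (ddy p)" "cont_strip (ddx (ddx p))" "cont_strip (ddy (ddy p))"
    using p1 by (auto intro: Ck_strip_imp_cont_strip[of 1] Ck_strip_imp_cont_strip[of 0])
  have "square_integral (\<lambda>x y. p x y * laplacian p x y)
      = square_integral (\<lambda>x y. p x y * ddx (ddx p) x y) + square_integral (\<lambda>x y. p x y * ddy (ddy p) x y)"
    unfolding laplacian_def distrib_left by (intro square_integral_add cont_strip_intros c)
  moreover have "square_integral (\<lambda>x y. p x y * ddx (ddx p) x y) = - square_integral (\<lambda>x y. ddx p x y * ddx p x y)"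
    by (intro square_integral_by_parts_x p p1 periodic_strip_ddx)
  moreover have "square_integral (\<lambda>x y. p x y * ddy (ddy p) x y) + square_integral (\<lambda>x y. ddy p x y * ddy p x y)
      = square_integral (\<lambda>x y. p x y * ddy h x y) + square_integral (\<lambda>x y. ddy p x y * h x y)"
    unfolding square_integral_by_parts_y[OF p1(1) p1(3)] square_integral_by_parts_y[OF p1(1) h] walls ..
  moreover have "square_integral (\<lambda>x y. (norm (grad p x y))\<^sup>2)
      = square_integral (\<lambda>x y. ddx p x y * ddx p x y) + square_integral (\<lambda>x y. ddy p x y * ddy p x y)"
    unfolding norm_grad_power2 power2_eq_square[of "ddx p _ _"] power2_eq_square[of "ddy p _ _"]
    by (intro square_integral_add cont_strip_intros c)
  ultimately show ?thesis by linarith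
qed

section \<open>Poincare's inequality on horizontal lines\<close>

text \<open>
  Jensen's inequality for the square: with \<open>m\<close> the mean of \<open>g\<close>, integrate \<open>(g - m)\<^sup>2 \<ge> 0\<close>.
\<close>

lemma integral_power2_le:
  fixes g :: "real \<Rightarrow> real"
  assumes "continuous_on {0..1} g"
  shows "(integral {0..1} g)\<^sup>2 \<le> integral {0..1} (\<lambda>x. (g x)\<^sup>2)"
proof -
  define m where "m = integral {0..1} g"
  have "integral {0..1} (\<lambda>x. 2 * m * g x - m\<^sup>2) \<le> integral {0..1} (\<lambda>x. (g x)\<^sup>2)"
  proof (rule integral_le)
    fix x show "2 * m * g x - m\<^sup>2 \<le> (g x)\<^sup>2"
      using zero_le_power2[of "g x - m"] by (simp add: power2_diff mult_ac)
  qed (intro integrable_continuous_interval continuous_intros assms)+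
  also have "integral {0..1} (\<lambda>x. 2 * m * g x - m\<^sup>2) = 2 * m * m - m\<^sup>2"
    by (subst integral_diff)
      (auto simp: m_def intro!: integrable_continuous_interval continuous_intros assms)
  finally show ?thesis by (simp add: m_def power2_eq_square)
qed

text \<open>
  Young's inequality with the weights that leave half of the energy on the left in
  \<open>neumann_energy_estimate\<close>.
\<close>

lemma mult_le_quarter_power2_add: "a * b \<le> 1 / 4 * a\<^sup>2 + (b :: real)\<^sup>2"
  using zero_le_power2[of "a / 2 - b"] by (simp add: power2_eq_square algebra_simps)

text \<open>
  One-dimensional Poincare inequality in pointwise form: the increment is at most the integral of \<open>\<bar>q'\<bar>\<close>
  over the whole interval, to which Jensen's inequality applies.
\<close>

lemma increment_power2_le:
  assumes "continuous_on {0..1} q'" "x \<in> {0..1}"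
    and "\<And>x. (q has_vector_derivative q' x) (at x)"
  shows "(q x - q 0)\<^sup>2 \<le> integral {0..1} (\<lambda>s. (q' s :: real)\<^sup>2)"
proof -
  have c: "continuous_on {0..x} q'"
    using assms(1,2) by (auto elim: continuous_on_subset)
  have "(q' has_integral q x - q 0) {0..x}"
    using assms by (intro fundamental_theorem_of_calculus) (auto intro: has_vector_derivative_at_within)
  then have "\<bar>q x - q 0\<bar> = norm (integral {0..x} q')"
    by (simp add: integral_unique)
  also have "\<dots> \<le> integral {0..x} (\<lambda>s. \<bar>q' s\<bar>)"
    by (rule integral_norm_bound_integral)
      (use c in \<open>auto intro!: integrable_continuous_interval continuous_intros\<close>)
  also have "\<dots> \<le> integral {0..1} (\<lambda>s. \<bar>q' s\<bar>)"
    by (rule integral_subset_le)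
      (use assms(1,2) c in \<open>auto intro!: integrable_continuous_interval continuous_intros\<close>)
  finally have "(q x - q 0)\<^sup>2 \<le> (integral {0..1} (\<lambda>s. \<bar>q' s\<bar>))\<^sup>2"
    by (metis abs_ge_zero power2_abs power_mono)
  also have "\<dots> \<le> integral {0..1} (\<lambda>s. \<bar>q' s\<bar>\<^sup>2)"
    by (rule integral_power2_le) (intro continuous_intros assms)
  finally show ?thesis by simp
qed

lemma row_integral_integrable:
  fixes g :: "real \<Rightarrow> real \<Rightarrow> real"
  assumes "cont_strip g"
  shows "(\<lambda>y. integral {0..1} (\<lambda>x. g x y)) integrable_on {0..1}"
proof -
  have "continuous_on (cbox (0, 0) (1, 1)) (\<lambda>(x, y). g x y)"
    using cont_strip_on_square[OF assms] by (simp add: unit_square_eq_cbox case_prod_beta)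
  from integral_integrable_2dim[OF swap_continuous[OF this]] show ?thesis by simp
qed

text \<open>
  On each horizontal line \<open>k\<close> is orthogonal to constants, so \<open>p\<close> may be replaced there by
  \<open>p(x,y) - p(0,y)\<close>, whose square is at most the integral of \<open>p\<^sub>x\<^sup>2\<close> along that line.  Thus \<open>p\<close>, which is
  determined only up to a constant, is controlled by its gradient, and only by the \<open>x\<close>-derivative.
\<close>

lemma square_integral_mult_mean_zero_le:
  assumes p: "Ck_strip 1 p" and k: "cont_strip k"
    and mean: "\<And>y. y \<in> {0..1} \<Longrightarrow> integral {0..1} (\<lambda>x. k x y) = 0"
  shows "square_integral (\<lambda>x y. p x y * k x y)
    \<le> 1 / 4 * square_integral (\<lambda>x y. (ddx p x y)\<^sup>2) + square_integral (\<lambda>x y. (k x y)\<^sup>2)"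
proof -
  have c: "cont_strip p" "cont_strip (ddx p)"
    using p by (auto intro: Ck_strip_imp_cont_strip[of 1] Ck_strip_imp_cont_strip[of 0])
  define A where "A y = integral {0..1} (\<lambda>x. (ddx p x y)\<^sup>2)" for y
  have row: "integral {0..1} (\<lambda>x. p x y * k x y) \<le> integral {0..1} (\<lambda>x. 1 / 4 * (ddx p x y)\<^sup>2 + (k x y)\<^sup>2)"
    if y: "y \<in> {0..1}" for y
  proof -
    have i: "continuous_on {0..1} (\<lambda>x. p x y)" "continuous_on {0..1} (\<lambda>x. k x y)" "continuous_on {0..1} (\<lambda>x. ddx p x y)"
      using c k y by (auto intro: cont_strip_row)
    have "integral {0..1} (\<lambda>x. p x y * k x y) = integral {0..1} (\<lambda>x. (p x y - p 0 y) * k x y + p 0 y * k x y)"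
      by (simp add: algebra_simps)
    also have "\<dots> = integral {0..1} (\<lambda>x. (p x y - p 0 y) * k x y)"
      by (subst integral_add) (auto simp: mean[OF y] intro!: integrable_continuous_interval continuous_intros i)
    also have "\<dots> \<le> integral {0..1} (\<lambda>x. 1 / 4 * A y + (k x y)\<^sup>2)"
    proof (rule integral_le)
      fix x :: real assume "x \<in> {0..1}"
      then have "(p x y - p 0 y)\<^sup>2 \<le> A y"
        unfolding A_def by (intro increment_power2_le i Ck_strip_has_ddx[of 0]) (use p y in auto)
      then show "(p x y - p 0 y) * k x y \<le> 1 / 4 * A y + (k x y)\<^sup>2"
        using mult_le_quarter_power2_add[of "p x y - p 0 y" "k x y"] by simp
    qed (intro integrable_continuous_interval continuous_intros i)+
    also have "\<dots> = 1 / 4 * A y + integral {0..1} (\<lambda>x. (k x y)\<^sup>2)"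
      by (subst integral_add) (auto intro!: integrable_continuous_interval continuous_intros i)
    also have "\<dots> = integral {0..1} (\<lambda>x. 1 / 4 * (ddx p x y)\<^sup>2 + (k x y)\<^sup>2)"
      unfolding A_def by (subst integral_add) (auto intro!: integrable_continuous_interval continuous_intros i)
    finally show ?thesis .
  qed
  have f: "cont_strip (\<lambda>x y. p x y * k x y)" "cont_strip (\<lambda>x y. 1 / 4 * (ddx p x y)\<^sup>2 + (k x y)\<^sup>2)"
    "cont_strip (\<lambda>x y. 1 / 4 * (ddx p x y)\<^sup>2)" "cont_strip (\<lambda>x y. (k x y)\<^sup>2)"
    by (intro cont_strip_intros c k)+
  have "square_integral (\<lambda>x y. p x y * k x y) \<le> square_integral (\<lambda>x y. 1 / 4 * (ddx p x y)\<^sup>2 + (k x y)\<^sup>2)"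
    unfolding square_integral_yx[OF f(1)] square_integral_yx[OF f(2)]
    by (intro integral_le row_integral_integrable f row)
  then show ?thesis
    by (simp only: square_integral_add[OF f(3,4)] square_integral_mult)
qed

text \<open>
  The mean over a horizontal line is a function of \<open>y\<close> alone that vanishes identically, and its
  derivative is the mean of \<open>g\<^sub>y\<close>, by differentiation under the integral sign.
\<close>

lemma row_mean_zero_ddy:
  assumes g: "Ck_strip 1 g" and mean: "\<And>y. y \<in> {0..1} \<Longrightarrow> integral {0..1} (\<lambda>x. g x y) = 0" and y: "y \<in> {0..1}"
  shows "integral {0..1} (\<lambda>x. ddy g x y) = (0::real)"
proof -
  have c: "cont_strip g" "cont_strip (ddy g)"
    using g by (auto intro: Ck_strip_imp_cont_strip[of 1] Ck_strip_imp_cont_strip[of 0])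
  have "((\<lambda>y. integral (cbox 0 1) (\<lambda>x. g x y)) has_vector_derivative integral (cbox 0 1) (\<lambda>x. ddy g x y))
      (at y within {0..1})"
  proof (rule leibniz_rule_vector_derivative)
    show "continuous_on ({0..1} \<times> cbox 0 1) (\<lambda>(y, x). ddy g x y)"
    proof -
      have "continuous_on ({0..1} \<times> cbox 0 1) ((\<lambda>z. ddy g (fst z) (snd z)) \<circ> prod.swap)"
        by (rule continuous_on_compose)
          (use c(2) in \<open>auto simp: cont_strip_def intro!: continuous_on_swap elim!: continuous_on_subset\<close>)
      then show ?thesis by (simp add: o_def case_prod_beta)
    qed
  qed (use g y cont_strip_row[OF c(1)] in \<open>auto intro!: Ck_strip_has_ddy[of 0] integrable_continuous_interval\<close>)
  then have "((\<lambda>y. 0) has_vector_derivative integral {0..1} (\<lambda>x. ddy g x y)) (at y within {0..1})"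
    unfolding box_real by (rule has_vector_derivative_transform[OF y, rotated]) (simp add: mean)
  then show ?thesis
    using ddy_eqI[of "\<lambda>x y. 0"] ddy_eqI[of "\<lambda>x y. 0" 0 0 y] y by (metis has_vector_derivative_const)
qed

section \<open>Energy estimates for the Neumann problem\<close>

lemma norm_add_power2_le: "(norm (a + b))\<^sup>2 \<le> 2 * (norm a)\<^sup>2 + 2 * (norm (b :: 'a :: real_normed_vector))\<^sup>2"
proof -
  have "(norm (a + b))\<^sup>2 \<le> (norm a + norm b)\<^sup>2"
    by (intro power_mono norm_triangle_ineq) auto
  also have "\<dots> \<le> 2 * (norm a)\<^sup>2 + 2 * (norm b)\<^sup>2"
    using zero_le_power2[of "norm a - norm b"] by (simp add: power2_eq_square algebra_simps)
  finally show ?thesis .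
qed

lemma cont_strip_grad:
  assumes "Ck_strip 1 p"
  shows "cont_strip (grad p)"
proof -
  have "cont_strip (ddx p)" "cont_strip (ddy p)"
    using assms by (auto intro: Ck_strip_imp_cont_strip[of 0])
  moreover have "grad p = (\<lambda>x y. ddx p x y *\<^sub>R vector [1, 0] + ddy p x y *\<^sub>R vector [0, 1])"
    by (simp add: fun_eq_iff grad_def vec_eq_iff forall_2 vector_2)
  ultimately show ?thesis
    by (simp add: cont_strip_def continuous_on_add continuous_on_scaleR)
qed

text \<open>
  Both pressure problems have this form.  The equation is tested against \<open>p\<close>, and the divergence is
  moved from \<open>F\<close> to \<open>p\<close>.
\<close>

lemma neumann_energy_identity:
  assumes p: "Ck_strip 2 p" "periodic_strip p"
    and F: "Ck_strip 1 F" "periodic_strip F" "\<And>x. F x 0 $ 2 = 0" "\<And>x. F x 1 $ 2 = 0"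
    and eq: "\<And>x y. y \<in> {0..1} \<Longrightarrow> laplacian p x y = - divergence F x y"
    and h: "Ck_strip 1 h" and walls: "\<And>x. ddy p x 0 = h x 0" "\<And>x. ddy p x 1 = h x 1"
  shows "square_integral (\<lambda>x y. (norm (grad p x y))\<^sup>2) = - square_integral (\<lambda>x y. grad p x y \<bullet> F x y)
    + square_integral (\<lambda>x y. p x y * ddy h x y) + square_integral (\<lambda>x y. ddy p x y * h x y)"
proof -
  have p1: "Ck_strip 1 p" using p Ck_strip_SucD[of 1 p] by (simp add: numeral_2_eq_2)
  have "square_integral (\<lambda>x y. p x y * laplacian p x y) = square_integral (\<lambda>x y. -1 * (p x y * divergence F x y))"
    by (rule square_integral_cong) (simp add: eq)
  also have "\<dots> = square_integral (\<lambda>x y. grad p x y \<bullet> F x y)"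
    by (simp only: square_integral_mult square_integral_divergence[OF p1 p(2) F])
  finally show ?thesis
    using dirichlet_energy_identity[OF p h walls] by (simp only:)
qed

text \<open>
  Young's inequality.  It is used with \<open>a = 1/2\<close>, which gives the sharp constant \<open>1\<close> for homogeneous
  wall data, and with \<open>a = 1/4\<close>, which leaves room to absorb the terms coming from the walls.
\<close>

lemma minus_square_integral_inner_le:
  fixes v w :: "real \<Rightarrow> real \<Rightarrow> real ^ 2"
  assumes c: "cont_strip v" "cont_strip w" and a: "a > 0"
  shows "- square_integral (\<lambda>x y. v x y \<bullet> w x y)
    \<le> a * square_integral (\<lambda>x y. (norm (v x y))\<^sup>2) + 1 / (4 * a) * square_integral (\<lambda>x y. (norm (w x y))\<^sup>2)"
proof -
  have n: "cont_strip (\<lambda>x y. (norm (v x y))\<^sup>2)" "cont_strip (\<lambda>x y. (norm (w x y))\<^sup>2)"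
    by (intro cont_strip_intros c)+
  have i: "cont_strip (\<lambda>x y. v x y \<bullet> w x y)"
    using c unfolding cont_strip_def by (intro continuous_intros)
  have "square_integral (\<lambda>x y. -1 * (v x y \<bullet> w x y))
      \<le> square_integral (\<lambda>x y. a * (norm (v x y))\<^sup>2 + 1 / (4 * a) * (norm (w x y))\<^sup>2)"
  proof (rule square_integral_mono)
    fix x y :: real
    have "0 \<le> (norm ((2 * a) *\<^sub>R v x y + w x y))\<^sup>2" by simp
    also have "\<dots> = 4 * a * (a * (norm (v x y))\<^sup>2 + 1 / (4 * a) * (norm (w x y))\<^sup>2 + v x y \<bullet> w x y)"
      using a unfolding power2_norm_eq_inner by (simp add: inner_add inner_commute field_simps)
    finally show "-1 * (v x y \<bullet> w x y) \<le> a * (norm (v x y))\<^sup>2 + 1 / (4 * a) * (norm (w x y))\<^sup>2"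
      using a by (simp add: zero_le_mult_iff)
  qed (intro cont_strip_intros i n)+
  also have "\<dots> = a * square_integral (\<lambda>x y. (norm (v x y))\<^sup>2) + 1 / (4 * a) * square_integral (\<lambda>x y. (norm (w x y))\<^sup>2)"
    by (subst square_integral_add) (intro cont_strip_intros n | simp only: square_integral_mult)+
  finally show ?thesis by (simp only: square_integral_mult)
qed

lemma homogeneous_neumann_energy_estimate:
  assumes p: "Ck_strip 2 p" "periodic_strip p"
    and F: "Ck_strip 1 F" "periodic_strip F" "\<And>x. F x 0 $ 2 = 0" "\<And>x. F x 1 $ 2 = 0"
    and eq: "\<And>x y. y \<in> {0..1} \<Longrightarrow> laplacian p x y = - divergence F x y"
    and walls: "\<And>x. ddy p x 0 = 0" "\<And>x. ddy p x 1 = 0"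
  shows "(L2_norm (grad p))\<^sup>2 \<le> (L2_norm F)\<^sup>2"
proof -
  have p1: "Ck_strip 1 p" using p Ck_strip_SucD[of 1 p] by (simp add: numeral_2_eq_2)
  have c: "cont_strip (grad p)" "cont_strip F"
    using p1 F(1) by (auto intro: cont_strip_grad Ck_strip_imp_cont_strip[of 1] simp del: Ck_strip.simps)
  have n: "cont_strip (\<lambda>x y. (norm (grad p x y))\<^sup>2)" "cont_strip (\<lambda>x y. (norm (F x y))\<^sup>2)"
    by (intro cont_strip_intros c)+
  have "square_integral (\<lambda>x y. (norm (grad p x y))\<^sup>2) = - square_integral (\<lambda>x y. grad p x y \<bullet> F x y)"
  proof -
    have "square_integral (\<lambda>x y. p x y * ddy (\<lambda>x y. 0) x y) = square_integral (\<lambda>x y. 0)"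
      by (rule square_integral_cong) (simp add: ddy_eqI)
    then show ?thesis
      using neumann_energy_identity[OF p F eq Ck_strip_const walls] by (simp add: square_integral_def)
  qed
  then show ?thesis
    using minus_square_integral_inner_le[OF c, of "1 / 2"]
    by (simp add: L2_norm_power2[OF n(1)] L2_norm_power2[OF n(2)])
qed

text \<open>
  Of the three terms of the energy identity, the source term costs a quarter of the whole energy, the term
  \<open>p\<^sub>y h\<close> a quarter of its \<open>y\<close>-part and the term \<open>p h\<^sub>y\<close> a quarter of its \<open>x\<close>-part.  Together this is half of
  the energy, which is absorbed on the left.
\<close>

lemma neumann_energy_estimate:
  assumes p: "Ck_strip 2 p" "periodic_strip p"
    and F: "Ck_strip 1 F" "periodic_strip F" "\<And>x. F x 0 $ 2 = 0" "\<And>x. F x 1 $ 2 = 0"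
    and eq: "\<And>x y. y \<in> {0..1} \<Longrightarrow> laplacian p x y = - divergence F x y"
    and h: "Ck_strip 1 h" "\<And>y. y \<in> {0..1} \<Longrightarrow> integral {0..1} (\<lambda>x. ddy h x y) = 0"
    and walls: "\<And>x. ddy p x 0 = h x 0" "\<And>x. ddy p x 1 = h x 1"
  shows "(L2_norm (grad p))\<^sup>2 \<le> 2 * ((L2_norm F)\<^sup>2 + (L2_norm h)\<^sup>2 + (L2_norm (ddy h))\<^sup>2)"
proof -
  have p1: "Ck_strip 1 p" using p Ck_strip_SucD[of 1 p] by (simp add: numeral_2_eq_2)
  have c: "cont_strip (grad p)" "cont_strip F" "cont_strip h" "cont_strip (ddy h)" "cont_strip (ddx p)" "cont_strip (ddy p)"
    using p1 F(1) h(1) by (auto intro: cont_strip_grad Ck_strip_imp_cont_strip[of 1] Ck_strip_imp_cont_strip[of 0])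
  have n: "cont_strip (\<lambda>x y. (norm (grad p x y))\<^sup>2)" "cont_strip (\<lambda>x y. (norm (F x y))\<^sup>2)"
    "cont_strip (\<lambda>x y. (h x y)\<^sup>2)" "cont_strip (\<lambda>x y. (ddy h x y)\<^sup>2)"
    "cont_strip (\<lambda>x y. (ddx p x y)\<^sup>2)" "cont_strip (\<lambda>x y. (ddy p x y)\<^sup>2)"
    by (intro cont_strip_intros c)+
  let ?E = "square_integral (\<lambda>x y. (norm (grad p x y))\<^sup>2)"
  have "- square_integral (\<lambda>x y. grad p x y \<bullet> F x y) \<le> 1 / 4 * ?E + square_integral (\<lambda>x y. (norm (F x y))\<^sup>2)"
    using minus_square_integral_inner_le[OF c(1,2), of "1 / 4"] by simp
  moreover have "square_integral (\<lambda>x y. ddy p x y * h x y)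
      \<le> 1 / 4 * square_integral (\<lambda>x y. (ddy p x y)\<^sup>2) + square_integral (\<lambda>x y. (h x y)\<^sup>2)"
  proof -
    have "square_integral (\<lambda>x y. ddy p x y * h x y) \<le> square_integral (\<lambda>x y. 1 / 4 * (ddy p x y)\<^sup>2 + (h x y)\<^sup>2)"
      by (intro square_integral_mono mult_le_quarter_power2_add cont_strip_intros c n)
    also have "\<dots> = 1 / 4 * square_integral (\<lambda>x y. (ddy p x y)\<^sup>2) + square_integral (\<lambda>x y. (h x y)\<^sup>2)"
      by (subst square_integral_add) (intro cont_strip_intros n | simp only: square_integral_mult)+
    finally show ?thesis .
  qed
  moreover have "square_integral (\<lambda>x y. p x y * ddy h x y)
      \<le> 1 / 4 * square_integral (\<lambda>x y. (ddx p x y)\<^sup>2) + square_integral (\<lambda>x y. (ddy h x y)\<^sup>2)"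
    by (intro square_integral_mult_mean_zero_le p1 c h(2))
  moreover have "?E = square_integral (\<lambda>x y. (ddx p x y)\<^sup>2) + square_integral (\<lambda>x y. (ddy p x y)\<^sup>2)"
    unfolding norm_grad_power2 by (intro square_integral_add n)
  moreover have "?E = - square_integral (\<lambda>x y. grad p x y \<bullet> F x y)
      + square_integral (\<lambda>x y. p x y * ddy h x y) + square_integral (\<lambda>x y. ddy p x y * h x y)"
    by (rule neumann_energy_identity[OF p F _ h(1) walls]) (rule eq)
  ultimately have "?E \<le> 2 * (square_integral (\<lambda>x y. (norm (F x y))\<^sup>2)
      + square_integral (\<lambda>x y. (h x y)\<^sup>2) + square_integral (\<lambda>x y. (ddy h x y)\<^sup>2))"
    by argo
  then show ?thesis
    using n by (simp add: L2_norm_power2)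
qed

section \<open>Fluxes of an incompressible no-slip flow\<close>

text \<open>
  Incompressibility gives \<open>v\<^sub>2\<^sub>y = - v\<^sub>1\<^sub>x\<close>, and the \<open>x\<close>-derivative of a periodic function has mean zero.
\<close>

lemma row_mean_zero_ddy_of_divergence_free:
  assumes v: "Ck_strip 1 v" "periodic_strip v"
    and div: "\<And>x. divergence v x y = 0" and y: "y \<in> {0..1}"
  shows "integral {0..1} (\<lambda>x. ddy (\<lambda>x y. v x y $ 2) x y) = 0"
proof -
  have v1: "Ck_strip (Suc 0) (\<lambda>x y. v x y $ 1)" using v(1) Ck_strip_component[of 1 v] by simp
  have "(\<lambda>x. ddy (\<lambda>x y. v x y $ 2) x y) = (\<lambda>x. - ddx (\<lambda>x y. v x y $ 1) x y)"
    using div by (simp add: fun_eq_iff divergence_def add_eq_0_iff)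
  moreover have "((\<lambda>x. ddx (\<lambda>x y. v x y $ 1) x y) has_integral v 1 y $ 1 - v 0 y $ 1) {0..1}"
    by (rule fundamental_theorem_of_calculus)
      (use has_vector_derivative_at_within[OF Ck_strip_has_ddx[OF v1 y]] in auto)
  moreover have "v 1 y = v 0 y"
    using v(2) y unfolding periodic_strip_def by (metis add_0)
  ultimately show ?thesis by (simp add: integral_unique)
qed

lemma H_norm_1_power2:
  fixes v :: "real \<Rightarrow> real \<Rightarrow> real ^ 2"
  assumes "Ck_strip 1 v"
  shows "(H_norm 1 v)\<^sup>2 = square_integral (\<lambda>x y. (norm (v x y))\<^sup>2)
    + square_integral (\<lambda>x y. (norm (ddx v x y))\<^sup>2) + square_integral (\<lambda>x y. (norm (ddy v x y))\<^sup>2)"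
proof -
  have c: "cont_strip v" "cont_strip (ddx v)" "cont_strip (ddy v)"
    using assms by (auto intro: Ck_strip_imp_cont_strip[of 1] Ck_strip_imp_cont_strip[of 0])
  have n: "cont_strip (\<lambda>x y. (norm (v x y))\<^sup>2)" "cont_strip (\<lambda>x y. (norm (ddx v x y))\<^sup>2)"
     "cont_strip (\<lambda>x y. (norm (ddy v x y))\<^sup>2)"
    by (intro cont_strip_intros c)+
  have "(D_norm 0 v)\<^sup>2 = square_integral (\<lambda>x y. (norm (v x y))\<^sup>2)"
    unfolding D_norm_def using n by (subst L2_norm_power2) simp_all
  moreover have "(D_norm 1 v)\<^sup>2 = square_integral (\<lambda>x y. (norm (ddx v x y))\<^sup>2 + (norm (ddy v x y))\<^sup>2)"
    unfolding D_norm_def using cont_strip_intros(1)[OF n(2,3)] by (subst L2_norm_power2) simp_all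
  moreover have "(H_norm 1 v)\<^sup>2 = (D_norm 0 v)\<^sup>2 + (D_norm 1 v)\<^sup>2"
    by (simp add: H_norm_def)
  ultimately show ?thesis by (simp add: square_integral_add[OF n(2,3)])
qed

lemma ddx_couette: "ddx couette x y = 0"
  by (rule ddx_eqI) (simp add: couette_def)

lemma ddy_couette: "y \<in> {0..1} \<Longrightarrow> ddy couette x y = vector [1, 0]"
  by (rule ddy_eqI) (auto simp: couette_def intro!: bounded_linear.has_vector_derivative[OF bounded_linear_vector_first, of "\<lambda>s. s" 1, simplified])

text \<open>
  The source of the linear pressure is minus the divergence of this field, which on the strip equals
  \<open>(v\<^sub>2, 0) + y v\<^sub>x\<close>.
\<close>

definition couette_flux :: "(real \<Rightarrow> real \<Rightarrow> real ^ 2) \<Rightarrow> real \<Rightarrow> real \<Rightarrow> real ^ 2" where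
  "couette_flux v x y = advect v couette x y + advect couette v x y"

lemma Ck_strip_couette_flux:
  "Ck_strip (Suc k) v \<Longrightarrow> Ck_strip k (couette_flux v)"
  using Ck_strip_add[OF Ck_strip_advect[OF _ Ck_strip_couette] Ck_strip_advect[OF Ck_strip_couette], of k v v]
  by (simp add: couette_flux_def[abs_def] del: Ck_strip.simps)

lemma divergence_add:
  assumes "Ck_strip (Suc 0) F" "Ck_strip (Suc 0) G" "y \<in> {0..1}"
  shows "divergence (\<lambda>x y. F x y + G x y) x y = divergence F x y + divergence G x y"
proof -
  note C = Ck_strip_component[OF assms(1)] Ck_strip_component[OF assms(2)]
  have "ddx (\<lambda>x y. (F x y + G x y) $ 1) x y = ddx (\<lambda>x y. F x y $ 1) x y + ddx (\<lambda>x y. G x y $ 1) x y"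
    by (rule ddx_eqI) (auto intro!: has_vector_derivative_add Ck_strip_has_ddx[OF C(1) assms(3)] Ck_strip_has_ddx[OF C(2) assms(3)])
  moreover have "ddy (\<lambda>x y. (F x y + G x y) $ 2) x y = ddy (\<lambda>x y. F x y $ 2) x y + ddy (\<lambda>x y. G x y $ 2) x y"
    by (rule ddy_eqI[OF _ assms(3)])
      (auto intro!: has_vector_derivative_add Ck_strip_has_ddy[OF C(1) assms(3)] Ck_strip_has_ddy[OF C(2) assms(3)])
  ultimately show ?thesis by (simp add: divergence_def)
qed

text \<open>
  At \<open>y = 0\<close> both \<open>v\<close> and \<open>U\<close> vanish; at \<open>y = 1\<close> the remaining term \<open>v\<^sub>x\<close> vanishes because \<open>v\<close> is zero along
  the whole wall.
\<close>

lemma couette_flux_wall: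
  assumes "\<And>x. v x 0 = 0" "\<And>x. v x 1 = 0"
  shows "couette_flux v x 0 $ 2 = 0" "couette_flux v x 1 $ 2 = 0"
proof -
  have "ddx v x 1 = 0" by (rule ddx_eqI) (simp add: assms)
  then show "couette_flux v x 0 $ 2 = 0" "couette_flux v x 1 $ 2 = 0"
    by (simp_all add: couette_flux_def advect_def assms couette_def vector_2)
qed

text \<open>
  The flux contains no derivative of \<open>v\<close> beyond the first, which is why the linear pressure is bounded by
  the \<open>H\<^sup>1\<close> norm of the velocity, up to the contribution of the wall data.
\<close>

lemma L2_norm_couette_flux_le:
  assumes v: "Ck_strip 2 v"
  shows "(L2_norm (couette_flux v))\<^sup>2 \<le> 2 * (H_norm 1 v)\<^sup>2"
proof -
  have v1: "Ck_strip 1 v" "Ck_strip 1 (couette_flux v)"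
    using v Ck_strip_SucD[of 1 v] Ck_strip_couette_flux[of 1 v] by (simp_all add: numeral_2_eq_2 del: Ck_strip.simps)
  have c: "cont_strip v" "cont_strip (ddx v)" "cont_strip (ddy v)" "cont_strip (couette_flux v)"
    using v1 by (auto intro: Ck_strip_imp_cont_strip[of 1] Ck_strip_imp_cont_strip[of 0])
  have n: "cont_strip (\<lambda>x y. (norm (v x y))\<^sup>2)" "cont_strip (\<lambda>x y. (norm (ddx v x y))\<^sup>2)"
     "cont_strip (\<lambda>x y. (norm (ddy v x y))\<^sup>2)" "cont_strip (\<lambda>x y. (norm (couette_flux v x y))\<^sup>2)"
    by (intro cont_strip_intros c)+
  have "square_integral (\<lambda>x y. (norm (couette_flux v x y))\<^sup>2)
      \<le> square_integral (\<lambda>x y. 2 * (norm (v x y))\<^sup>2 + 2 * (norm (ddx v x y))\<^sup>2)"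
  proof (rule square_integral_mono)
    fix x y :: real assume y: "y \<in> {0..1}"
    have "couette_flux v x y = (v x y $ 2) *\<^sub>R vector [1, 0] + y *\<^sub>R ddx v x y"
      by (simp add: couette_flux_def advect_def ddx_couette ddy_couette[OF y]) (simp add: couette_def vector_2)
    then have "(norm (couette_flux v x y))\<^sup>2 \<le> 2 * (norm ((v x y $ 2) *\<^sub>R vector [1, 0] :: real ^ 2))\<^sup>2 + 2 * (norm (y *\<^sub>R ddx v x y))\<^sup>2"
      by (simp only: norm_add_power2_le)
    moreover have "(norm ((v x y $ 2) *\<^sub>R vector [1, 0] :: real ^ 2))\<^sup>2 \<le> (norm (v x y))\<^sup>2"
      by (simp add: norm_vec_def L2_set_def UNIV_2 vector_2)
    moreover have "(norm (y *\<^sub>R ddx v x y))\<^sup>2 \<le> (norm (ddx v x y))\<^sup>2"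
      using y by (intro power_mono) (auto simp: mult_left_le_one_le)
    ultimately show "(norm (couette_flux v x y))\<^sup>2 \<le> 2 * (norm (v x y))\<^sup>2 + 2 * (norm (ddx v x y))\<^sup>2" by linarith
  qed (intro cont_strip_intros n)+
  also have "\<dots> = 2 * square_integral (\<lambda>x y. (norm (v x y))\<^sup>2) + 2 * square_integral (\<lambda>x y. (norm (ddx v x y))\<^sup>2)"
    by (subst square_integral_add) (intro cont_strip_intros n | simp only: square_integral_mult)+
  also have "\<dots> \<le> 2 * (H_norm 1 v)\<^sup>2"
    using square_integral_nonneg[OF n(3)] unfolding H_norm_1_power2[OF v1(1)] by simp
  finally show ?thesis by (simp add: L2_norm_power2[OF n(4)])
qed

lemma L2_norm_scale_power2:
  fixes f g :: "real \<Rightarrow> real \<Rightarrow> real"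
  assumes "\<And>x y. y \<in> {0..1} \<Longrightarrow> f x y = c * g x y"
  shows "(L2_norm f)\<^sup>2 = c\<^sup>2 * (L2_norm g)\<^sup>2"
proof -
  have "(LINT z:{0..1} \<times> {0..1}|lborel. (norm (f (fst z) (snd z)))\<^sup>2)
      = (LINT z:{0..1} \<times> {0..1}|lborel. c\<^sup>2 * (norm (g (fst z) (snd z)))\<^sup>2)"
    by (rule set_lebesgue_integral_cong)
      (auto simp: assms power_mult_distrib unit_square_eq_cbox[symmetric] intro: borel_Times)
  then show ?thesis
    by (simp add: L2_norm_def real_sqrt_mult power_mult_distrib)
qed

section \<open>The pressure estimates\<close>

theorem theorem6p1:
  "\<exists>C::real. \<forall>(R::real) (\<epsilon>::real) (f :: real \<Rightarrow> real \<Rightarrow> real ^ 2)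
      (u :: real \<Rightarrow> real \<Rightarrow> real \<Rightarrow> real ^ 2)
      (p1 :: real \<Rightarrow> real \<Rightarrow> real \<Rightarrow> real) (p2 :: real \<Rightarrow> real \<Rightarrow> real \<Rightarrow> real).
    R > 0 \<longrightarrow>
    initial_datum R f \<longrightarrow>
    perturbation_solution R \<epsilon> couette f u p1 p2 \<longrightarrow>
    pressure1_solution R couette u p1 \<longrightarrow>
    pressure2_solution u p2 \<longrightarrow>
    (\<forall>t\<ge>0.
      (L2_norm (grad (p1 t)))\<^sup>2
        \<le> C * ((H_norm 1 (u t))\<^sup>2
              + 1 / R\<^sup>2 * (L2_norm (ddy (ddy (\<lambda>x y. u t x y $ 2))))\<^sup>2
              + 1 / R\<^sup>2 * (L2_norm (ddy (ddy (ddy (\<lambda>x y. u t x y $ 2)))))\<^sup>2)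
      \<and> (L2_norm (grad (p2 t)))\<^sup>2 \<le> (L2_norm (advect (u t) (u t)))\<^sup>2)"
proof (intro exI[of _ 4] allI impI)
  fix R \<epsilon> :: real and f u p1 p2 and t :: real
  assume R: "R > 0" and "initial_datum R f" and u: "perturbation_solution R \<epsilon> couette f u p1 p2"
    and p1: "pressure1_solution R couette u p1" and p2: "pressure2_solution u p2" and t: "t \<ge> 0"
  define v where "v = u t"
  define w where "w = (\<lambda>x y. v x y $ 2)"
  define h where "h = (\<lambda>x y. (1 / R) * ddy (ddy w) x y)"
  have v: "Ck_strip k v" for k
    using u t unfolding v_def perturbation_solution_def smooth_spacetime_def
    by (intro Ck_spacetime_imp_Ck_strip) simp_all
  have per: "periodic_strip v" and noslip: "v x 0 = 0" "v x 1 = 0"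
    and div: "\<And>y. y \<in> {0..1} \<Longrightarrow> divergence v x y = 0" for x
    using u t unfolding v_def perturbation_solution_def by auto
  have w: "Ck_strip 3 w"
    unfolding w_def by (intro Ck_strip_component v)
  then have w': "Ck_strip 1 (ddy w)" "Ck_strip 1 (ddy (ddy w))"
    using Ck_strip_SucD[of 1 "ddy w"] by (auto simp: numeral_3_eq_3)
  have h: "Ck_strip 1 h"
    unfolding h_def real_scaleR_def[symmetric] by (intro Ck_strip_scaleR Ck_strip_const w')
  have dh: "ddy h x y = (1 / R) * ddy (ddy (ddy w)) x y" if "y \<in> {0..1}" for x y
    unfolding h_def
    by (rule ddy_eqI[OF _ that], rule has_vector_derivative_mult_right)
      (use w'(2) that in \<open>auto intro!: Ck_strip_has_ddy[of 0] simp del: Ck_strip.simps(1)\<close>)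
  have mean1: "integral {0..1} (\<lambda>x. ddy w x y) = 0" if "y \<in> {0..1}" for y
    unfolding w_def by (intro row_mean_zero_ddy_of_divergence_free v per div that)
  have mean3: "integral {0..1} (\<lambda>x. ddy (ddy (ddy w)) x y) = 0" if "y \<in> {0..1}" for y
    by (intro row_mean_zero_ddy w' mean1 that)
  have mean: "integral {0..1} (\<lambda>x. ddy h x y) = 0" if "y \<in> {0..1}" for y
    by (simp add: dh[OF that] mean3[OF that])
  \<comment> \<open>The flux \<open>(v \<cdot> \<nabla>) v\<close> vanishes on the walls together with \<open>v\<close>.\<close>
  have "(L2_norm (grad (p2 t)))\<^sup>2 \<le> (L2_norm (advect v v))\<^sup>2"
    using p2 t v unfolding pressure2_solution_def v_def[symmetric]
    by (intro homogeneous_neumann_energy_estimate Ck_strip_advect periodic_strip_advect per)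
      (auto simp: advect_def noslip v_def[symmetric] simp del: Ck_strip.simps)
  moreover have "(L2_norm (grad (p1 t)))\<^sup>2 \<le> 2 * ((L2_norm (couette_flux v))\<^sup>2 + (L2_norm h)\<^sup>2 + (L2_norm (ddy h))\<^sup>2)"
  proof (rule neumann_energy_estimate)
    show "Ck_strip 2 (p1 t)" "periodic_strip (p1 t)"
      using p1 t by (auto simp: pressure1_solution_def)
    show "Ck_strip 1 (couette_flux v)" "Ck_strip 1 h"
      by (intro Ck_strip_couette_flux v h)+
    have "periodic_strip couette" by (simp add: periodic_strip_def couette_def)
    then have "periodic_strip (advect v couette)" "periodic_strip (advect couette v)"
      by (intro periodic_strip_advect per; assumption)+
    then show "periodic_strip (couette_flux v)" by (simp add: periodic_strip_def couette_flux_def)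
    show "laplacian (p1 t) x y = - divergence (couette_flux v) x y" if "y \<in> {0..1}" for x y
    proof -
      have "divergence (couette_flux v) x y = divergence (advect v couette) x y + divergence (advect couette v) x y"
        unfolding couette_flux_def[abs_def]
        by (intro divergence_add Ck_strip_advect Ck_strip_couette v that)
      then show ?thesis
        using p1 t that by (simp add: pressure1_solution_def v_def)
    qed
    show "ddy (p1 t) x 0 = h x 0" "ddy (p1 t) x 1 = h x 1" for x
      using p1 t by (simp_all add: pressure1_solution_def h_def w_def v_def)
  qed (auto intro: couette_flux_wall noslip mean)
  moreover have "(L2_norm h)\<^sup>2 = (1 / R)\<^sup>2 * (L2_norm (ddy (ddy w)))\<^sup>2"
    by (rule L2_norm_scale_power2) (simp add: h_def)
  moreover have "(L2_norm (ddy h))\<^sup>2 = (1 / R)\<^sup>2 * (L2_norm (ddy (ddy (ddy w))))\<^sup>2"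
    by (intro L2_norm_scale_power2 dh)
  moreover have "0 \<le> (1 / R)\<^sup>2 * (L2_norm (ddy (ddy w)))\<^sup>2" "0 \<le> (1 / R)\<^sup>2 * (L2_norm (ddy (ddy (ddy w))))\<^sup>2"
    by simp_all
  moreover note L2_norm_couette_flux_le[OF v]
  ultimately show "(L2_norm (grad (p1 t)))\<^sup>2
        \<le> 4 * ((H_norm 1 (u t))\<^sup>2
              + 1 / R\<^sup>2 * (L2_norm (ddy (ddy (\<lambda>x y. u t x y $ 2))))\<^sup>2
              + 1 / R\<^sup>2 * (L2_norm (ddy (ddy (ddy (\<lambda>x y. u t x y $ 2)))))\<^sup>2)
      \<and> (L2_norm (grad (p2 t)))\<^sup>2 \<le> (L2_norm (advect (u t) (u t)))\<^sup>2"
    unfolding w_def v_def power_divide power_one distrib_left by argo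
qed

end
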